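(* Let $R$ be a transient irreducible random walk on $\mathbb{Z}$ (not necessarily symmetric) which has a harmonic measure. Let $A\subset\mathbb{Z}$ be finite and nonempty, $x\in\mathbb{Z}\setminus A$ and $a\in A$. Then the limit $$\mu(x,a)=\lim_{|y|\to\infty}\mathbb{P}_y\bigl(R_{T_A}=a,\;R_{T_A-1}=x\,\big|\,T_A<\infty\bigr)$$ exists and $$\mu(x,a)=\frac{p_{x,a}\,E_A^*(x)}{\operatorname{Cap}(A)}.$$
   Context: $\mathbb{P}_y$ is the law of the random walk started at $y$, $p_{x,a}=\mathbb{P}_x(R_1=a)$, and $T_A=\inf\{n>0:R_n\in A\}$. $E_A^*(x)$ is the probability that the reversed random walk (with step distribution $-R_1$ when $R_0=0$) started from $x$ never hits $A$ at a time $n>0$; this is defined for all $x$, including $x\in A$. The capacity of a finite set is $\operatorname{Cap}(A)=\sum_{a\in A}E_A^*(a)$. The walk $R$ is said to have a harmonic measure if for every finite nonempty $A\subset\mathbb{Z}$ and every $a\in A$ the limit $\lim_{|y|\to\infty}\mathbb{P}_y(R_{T_A}=a\mid T_A<\infty)$ exists and equals $E_A^*(a)/\operatorname{Cap}(A)$; equivalently, $\lim_{|x|\to\infty}G(x+b)/G(x)=1$ for every $b\in\mathbb{Z}$, where $G(x)=\sum_{n\ge0}\mathbb{P}_x(R_n=0)$. *)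

theory Defs
  imports "HOL-Probability.Probability"
begin

definition path_space :: "(nat \<Rightarrow> int) measure" where
  "path_space = PiM UNIV (\<lambda>_. count_space UNIV)"

text \<open>The walk is given by its step distribution \<open>p\<close>; \<open>rw_law p y\<close> is the law, on path space,
  of \<open>y\<close> plus the partial sums of an i.i.d. sequence with distribution \<open>p\<close>.\<close>

definition rw_law :: "int pmf \<Rightarrow> int \<Rightarrow> (nat \<Rightarrow> int) measure" where
  "rw_law p y = distr (stream_space (measure_pmf p)) path_space
     (\<lambda>\<xi> n. y + (\<Sum>i<n. \<xi> !! i))"

definition hit_time :: "int set \<Rightarrow> (nat \<Rightarrow> int) \<Rightarrow> enat" where
  "hit_time A R = (INF n\<in>{n. 0 < n \<and> R n \<in> A}. enat n)"

definition trans_prob :: "int pmf \<Rightarrow> int \<Rightarrow> int \<Rightarrow> real" where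
  "trans_prob p x a = \<P>(R in rw_law p x. R 1 = a)"

definition rw_irreducible :: "int pmf \<Rightarrow> bool" where
  "rw_irreducible p \<longleftrightarrow> (\<forall>x y. \<exists>n. \<P>(R in rw_law p x. R n = y) > 0)"

definition rw_transient :: "int pmf \<Rightarrow> bool" where
  "rw_transient p \<longleftrightarrow> \<P>(R in rw_law p 0. hit_time {0} R < \<infinity>) < 1"

definition rev_step :: "int pmf \<Rightarrow> int pmf" where
  "rev_step p = map_pmf uminus p"

definition rev_escape :: "int pmf \<Rightarrow> int set \<Rightarrow> int \<Rightarrow> real" where
  "rev_escape p A x = \<P>(R in rw_law (rev_step p) x. \<forall>n>0. R n \<notin> A)"

definition capacity :: "int pmf \<Rightarrow> int set \<Rightarrow> real" where
  "capacity p A = (\<Sum>a\<in>A. rev_escape p A a)"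

text \<open>The filter for \<open>\<bar>y\<bar> \<rightarrow> \<infinity>\<close> on the integers, two-sided; \<open>at_infinity\<close> is not available
  there, since \<open>int\<close> is not a normed vector space.\<close>

definition int_at_infinity :: "int filter" where
  "int_at_infinity = filtercomap abs at_top"

text \<open>The value of \<open>the_enat\<close> at \<open>\<infinity>\<close> is irrelevant: \<open>cond_prob\<close> intersects the event with
  the conditioning event.\<close>

definition has_harmonic_measure :: "int pmf \<Rightarrow> bool" where
  "has_harmonic_measure p \<longleftrightarrow>
     (\<forall>A a. finite A \<longrightarrow> A \<noteq> {} \<longrightarrow> a \<in> A \<longrightarrow>
       ((\<lambda>y. \<P>(R in rw_law p y. R (the_enat (hit_time A R)) = a \<bar> hit_time A R < \<infinity>))
         \<longlongrightarrow> rev_escape p A a / capacity p A) int_at_infinity)"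

lemma int_at_infinity_neq_bot: "int_at_infinity \<noteq> bot"
proof -
  have "\<exists>y. P \<bar>y\<bar>" if "eventually P at_top" for P :: "int \<Rightarrow> bool"
  proof -
    from that obtain N where "\<And>n. N \<le> n \<Longrightarrow> P n"
      unfolding eventually_at_top_linorder by blast
    hence "P \<bar>N\<bar>" by simp
    thus ?thesis ..
  qed
  thus ?thesis
    unfolding int_at_infinity_def by (intro filtercomap_neq_bot) auto
qed

text \<open>\<^const>\<open>measure\<close> is zero on non-measurable sets; the next facts ensure that the events
  used above are measurable, as are more generally the hitting time and the position of the
  path at measurable times.\<close>

lemma measurable_partial_sum:
  "(\<lambda>\<xi>. y + (\<Sum>i<n. \<xi> !! i)) \<in> stream_space (measure_pmf p) \<rightarrow>\<^sub>M count_space (UNIV :: int set)"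
proof (induction n)
  case (Suc n)
  have snth: "(\<lambda>\<xi>. \<xi> !! n) \<in> stream_space (measure_pmf p) \<rightarrow>\<^sub>M measure_pmf p"
    by (rule measurable_snth)
  have "(\<lambda>\<xi>. j + \<xi> !! n) \<in> stream_space (measure_pmf p) \<rightarrow>\<^sub>M count_space (UNIV :: int set)" for j
    by (rule measurable_compose[OF snth]) simp
  hence "(\<lambda>\<xi>. (\<lambda>j \<xi>. j + \<xi> !! n) (y + (\<Sum>i<n. \<xi> !! i)) \<xi>)
      \<in> stream_space (measure_pmf p) \<rightarrow>\<^sub>M count_space UNIV"
    by (rule measurable_compose_countable) (rule Suc.IH)
  thus ?case
    by (simp only: sum.lessThan_Suc add.assoc)
qed simp

lemma measurable_walk:
  "(\<lambda>\<xi> n. y + (\<Sum>i<n. \<xi> !! i)) \<in> stream_space (measure_pmf p) \<rightarrow>\<^sub>M path_space"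
  unfolding path_space_def
  by (rule measurable_PiM_single') (rule measurable_partial_sum, simp)

lemma prob_space_rw_law: "prob_space (rw_law p y)"
proof -
  interpret prob_space "stream_space (measure_pmf p)"
    by (rule prob_space.prob_space_stream_space) (rule prob_space_measure_pmf)
  show ?thesis
    unfolding rw_law_def by (rule prob_space_distr) (rule measurable_walk)
qed

lemma sets_rw_law [measurable_cong]: "sets (rw_law p y) = sets path_space"
  by (simp add: rw_law_def)

lemma measurable_path [measurable]:
  "(\<lambda>R. R n) \<in> path_space \<rightarrow>\<^sub>M count_space UNIV"
  unfolding path_space_def by (rule measurable_component_singleton) simp

lemma measurable_path_at:
  assumes "f \<in> path_space \<rightarrow>\<^sub>M count_space UNIV"
  shows "(\<lambda>R. R (f R)) \<in> path_space \<rightarrow>\<^sub>M count_space UNIV"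
  by (rule measurable_compose_countable[OF measurable_path assms])

lemma hit_time_eq:
  "hit_time A R =
     (if \<exists>n>0. R n \<in> A then enat (LEAST n. 0 < n \<and> R n \<in> A) else \<infinity>)"
proof (cases "\<exists>n>0. R n \<in> A")
  case True
  from LeastI_ex[OF this]
  have mem: "(LEAST n. 0 < n \<and> R n \<in> A) \<in> {n. 0 < n \<and> R n \<in> A}"
    by simp
  have "enat (LEAST n. 0 < n \<and> R n \<in> A) \<le> enat m" if "m \<in> {n. 0 < n \<and> R n \<in> A}" for m
    using that by (simp add: Least_le)
  hence "hit_time A R = enat (LEAST n. 0 < n \<and> R n \<in> A)"
    unfolding hit_time_def
    by (rule antisym[OF INF_lower[OF mem] INF_greatest])
  with True show ?thesis by simp
next
  case False
  hence none: "{n. 0 < n \<and> R n \<in> A} = {}" by auto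
  have "hit_time A R = \<infinity>"
    unfolding hit_time_def none by (simp add: top_enat_def)
  with False show ?thesis by simp
qed

lemma measurable_hit_time [measurable]:
  "hit_time A \<in> path_space \<rightarrow>\<^sub>M count_space UNIV"
proof -
  have "hit_time A = (\<lambda>R. if \<exists>n>0. R n \<in> A then enat (LEAST n. 0 < n \<and> R n \<in> A) else \<infinity>)"
    by (rule ext) (rule hit_time_eq)
  also have "\<dots> \<in> path_space \<rightarrow>\<^sub>M count_space UNIV"
    by measurable
  finally show ?thesis .
qed

end

theory Submission
  imports Defs
begin

text \<open>Let \<open>B = insert x A\<close>, and let \<open>G\<^sub>A\<close>, \<open>G\<^sub>B\<close> be the Green functions of the walk killed on \<open>A\<close> and
  on \<open>B\<close>. Entering \<open>A\<close> through the edge from \<open>x\<close> to \<open>a\<close> has probability \<open>G\<^sub>A(y, x) p(x, a)\<close> for \<open>y \<noteq> x\<close>, and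
  decomposing at the first visit to \<open>x\<close> gives \<open>G\<^sub>A(y, z) = G\<^sub>B(y, z) + G\<^sub>B(y, x) G\<^sub>A(x, z)\<close>. Since
  \<open>G\<^sub>B(y, b)\<close> for \<open>b \<in> B\<close> is the probability of hitting \<open>B\<close> at \<open>b\<close>, the harmonic measure of \<open>B\<close>
  determines the limit. Reversal exchanges the arguments of \<open>G\<close>, so the same decomposition
  relates the escape probabilities from \<open>A\<close> and from \<open>B\<close> and identifies the limit.\<close>

section \<open>Exchange of summation and a shifted Cauchy product\<close>

lemma nn_integral_count_space_commute:
  fixes f :: "'a::countable \<Rightarrow> 'b::countable \<Rightarrow> ennreal"
  shows "(\<integral>\<^sup>+v. (\<integral>\<^sup>+w. f v w \<partial>count_space UNIV) \<partial>count_space UNIV) =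
    (\<integral>\<^sup>+w. (\<integral>\<^sup>+v. f v w \<partial>count_space UNIV) \<partial>count_space UNIV)"
proof -
  interpret pair_sigma_finite "count_space (UNIV :: 'b set)" "count_space (UNIV :: 'a set)"
    by (intro pair_sigma_finite.intro sigma_finite_measure_count_space)
  show ?thesis
    by (rule Fubini') (simp add: pair_measure_countable)
qed

lemma nn_integral_count_space_indicator_singleton:
  fixes f :: "'a \<Rightarrow> ennreal"
  shows "(\<integral>\<^sup>+w. f w * indicator {x} w \<partial>count_space UNIV) = f x"
  by (subst nn_integral_indicator_singleton) (auto simp: one_ennreal_def[symmetric])

text \<open>The shift \<open>Suc k\<close> matches the indexing of the kernels below, where index
  \<open>n\<close> means time \<open>n + 1\<close>: times \<open>k + 1\<close> and
  \<open>n - k\<close> add up to \<open>n + 1\<close>. All terms are nonnegative, so the sums may be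
  exchanged.\<close>

lemma suminf_convolution_ennreal:
  fixes f g :: "nat \<Rightarrow> ennreal"
  shows "(\<Sum>n. \<Sum>k<n. f k * g (n - Suc k)) = (\<Sum>n. f n) * (\<Sum>n. g n)"
proof -
  have "(\<Sum>n. \<Sum>k<n. f k * g (n - Suc k)) =
      (\<Sum>n. \<Sum>k. f k * (if k < n then g (n - Suc k) else 0))"
    by (intro suminf_cong, subst suminf_finite[of "{..<_}"]) (auto intro!: sum.cong)
  also have "\<dots> = (\<Sum>k. \<Sum>n. f k * (if k < n then g (n - Suc k) else 0))"
    unfolding nn_integral_count_space_nat[symmetric]
    by (rule nn_integral_count_space_commute)
  also have "\<dots> = (\<Sum>k. f k * (\<Sum>n. if k < n then g (n - Suc k) else 0))"
    by simp
  also have "\<dots> = (\<Sum>k. f k * (\<Sum>n. g n))"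
  proof (rule suminf_cong)
    show "f k * (\<Sum>n. if k < n then g (n - Suc k) else 0) = f k * (\<Sum>n. g n)" for k
      using suminf_offset[of "\<lambda>n. if k < n then g (n - Suc k) else 0" "Suc k"] by simp
  qed
  finally show ?thesis by simp
qed

section \<open>Taboo kernels: reversal and first-visit decomposition\<close>

text \<open>Off by one: \<open>n\<close> counts the positions that must avoid \<open>A\<close>, and \<open>z\<close> is reached at time \<open>n + 1\<close>.\<close>

fun taboo :: "int pmf \<Rightarrow> int set \<Rightarrow> nat \<Rightarrow> int \<Rightarrow> int \<Rightarrow> ennreal" where
  "taboo p A 0 y z = pmf p (z - y)"
| "taboo p A (Suc n) y z =
     (\<integral>\<^sup>+w. ennreal (pmf p (w - y)) * indicator (- A) w * taboo p A n w z \<partial>count_space UNIV)"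

text \<open>The defining recursion splits off the first step, this one the last. Both sum the same
  path weights, in an order exchanged by Tonelli. Reversal needs the two forms side by side.\<close>

lemma taboo_Suc_right:
  "taboo p A (Suc n) y z =
     (\<integral>\<^sup>+w. taboo p A n y w * indicator (- A) w * ennreal (pmf p (z - w)) \<partial>count_space UNIV)"
proof (induction n arbitrary: y)
  case (Suc n)
  have "taboo p A (Suc (Suc n)) y z = (\<integral>\<^sup>+w. ennreal (pmf p (w - y)) * indicator (- A) w *
      (\<integral>\<^sup>+v. taboo p A n w v * indicator (- A) v * ennreal (pmf p (z - v)) \<partial>count_space UNIV) \<partial>count_space UNIV)"
    by (subst taboo.simps, subst Suc.IH) (rule refl)
  also have "\<dots> = (\<integral>\<^sup>+w. (\<integral>\<^sup>+v. ennreal (pmf p (w - y)) * indicator (- A) w *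
      (taboo p A n w v * indicator (- A) v * ennreal (pmf p (z - v))) \<partial>count_space UNIV) \<partial>count_space UNIV)"
    by (intro nn_integral_cong) (simp add: nn_integral_cmult)
  also have "\<dots> = (\<integral>\<^sup>+v. (\<integral>\<^sup>+w. ennreal (pmf p (w - y)) * indicator (- A) w *
      (taboo p A n w v * indicator (- A) v * ennreal (pmf p (z - v))) \<partial>count_space UNIV) \<partial>count_space UNIV)"
    by (rule nn_integral_count_space_commute)
  also have "\<dots> = (\<integral>\<^sup>+v. taboo p A (Suc n) y v * indicator (- A) v * ennreal (pmf p (z - v)) \<partial>count_space UNIV)"
    by (intro nn_integral_cong) (simp add: nn_integral_multc mult.assoc[symmetric])
  finally show ?case .
qed simp

lemma pmf_rev_step: "pmf (rev_step p) z = pmf p (- z)"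
proof -
  have "pmf (map_pmf uminus p) (- (- z)) = pmf p (- z)"
    by (rule pmf_map_inj') simp
  thus ?thesis by (simp add: rev_step_def)
qed

text \<open>A path read backwards has the same weight under the reversed steps and the same
  intermediate positions, so the taboo set stays as it is.\<close>

lemma taboo_rev_step: "taboo (rev_step p) A n y z = taboo p A n z y"
proof (induction n arbitrary: y)
  case (Suc n)
  show ?case
    by (subst taboo_Suc_right, subst taboo.simps)
       (intro nn_integral_cong, simp add: Suc.IH pmf_rev_step mult_ac)
qed (simp add: pmf_rev_step)

text \<open>Either the path avoids \<open>x\<close> at the intermediate times, or index
  \<open>k\<close> marks its first visit to \<open>x\<close>, from which it restarts.\<close>

lemma taboo_insert:
  assumes "x \<notin> A"
  shows "taboo p A n y z = taboo p (insert x A) n y z +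
    (\<Sum>k<n. taboo p (insert x A) k y x * taboo p A (n - Suc k) x z)"
proof (induction n arbitrary: y)
  case (Suc n)
  let ?B = "insert x A"
  \<comment> \<open>The first position \<open>w\<close> outside \<open>A\<close> is either outside
    \<open>?B\<close> or equal to \<open>x\<close>; the second case is the term \<open>k = 0\<close>
    of the new sum.\<close>
  have "taboo p A (Suc n) y z = (\<integral>\<^sup>+w. ennreal (pmf p (w - y)) * indicator (- ?B) w * taboo p A n w z +
      pmf p (w - y) * taboo p A n w z * indicator {x} w \<partial>count_space UNIV)"
    unfolding taboo.simps using assms
    by (intro nn_integral_cong) (auto split: split_indicator)
  also have "\<dots> = (\<integral>\<^sup>+w. ennreal (pmf p (w - y)) * indicator (- ?B) w * taboo p A n w z \<partial>count_space UNIV) +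
      pmf p (x - y) * taboo p A n x z"
    by (simp add: nn_integral_add nn_integral_count_space_indicator_singleton)
  also have "(\<integral>\<^sup>+w. ennreal (pmf p (w - y)) * indicator (- ?B) w * taboo p A n w z \<partial>count_space UNIV) =
      (\<integral>\<^sup>+w. ennreal (pmf p (w - y)) * indicator (- ?B) w * taboo p ?B n w z +
        (\<Sum>k<n. ennreal (pmf p (w - y)) * indicator (- ?B) w * taboo p ?B k w x * taboo p A (n - Suc k) x z)
        \<partial>count_space UNIV)"
    by (intro nn_integral_cong, subst Suc.IH) (simp add: distrib_left sum_distrib_left mult.assoc)
  also have "\<dots> = taboo p ?B (Suc n) y z +
      (\<Sum>k<n. taboo p ?B (Suc k) y x * taboo p A (n - Suc k) x z)"
    by (simp add: nn_integral_add nn_integral_sum nn_integral_multc)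
  finally show ?case
    by (subst sum.lessThan_Suc_shift) (simp add: add_ac)
qed simp

text \<open>The Green function at \<open>z\<close> of the walk killed at its first return to \<open>A\<close>, not counting time 0;
  for \<open>z \<in> A\<close> this is the probability that the walk started at \<open>y\<close> hits \<open>A\<close> at \<open>z\<close>.\<close>

definition taboo_green :: "int pmf \<Rightarrow> int set \<Rightarrow> int \<Rightarrow> int \<Rightarrow> ennreal" where
  "taboo_green p A y z = (\<Sum>n. taboo p A n y z)"

lemma taboo_green_rev_step: "taboo_green (rev_step p) A y z = taboo_green p A z y"
  by (simp add: taboo_green_def taboo_rev_step)

lemma taboo_green_insert:
  assumes "x \<notin> A"
  shows "taboo_green p A y z = taboo_green p (insert x A) y z +
    taboo_green p (insert x A) y x * taboo_green p A x z"
  unfolding taboo_green_def suminf_convolution_ennreal[symmetric]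
  by (subst suminf_add) (auto intro!: suminf_cong taboo_insert assms)

section \<open>The Markov property of the path law\<close>

lemma space_path_space: "space path_space = UNIV"
  by (auto simp: path_space_def space_PiM)

lemma space_rw_law: "space (rw_law p y) = UNIV"
  by (simp add: rw_law_def space_path_space)

lemma emeasure_rw_law:
  assumes [measurable]: "Measurable.pred path_space E"
  shows "emeasure (rw_law p y) {R. E R} =
    emeasure (stream_space (measure_pmf p)) {\<xi>\<in>space (stream_space (measure_pmf p)). E (\<lambda>n. y + (\<Sum>i<n. \<xi> !! i))}"
proof -
  have "{R. E R} \<in> sets path_space"
    using assms by (auto simp: pred_def space_path_space)
  thus ?thesis
    unfolding rw_law_def by (subst emeasure_distr[OF measurable_walk]) (auto simp: vimage_def Int_def conj_commute)
qed

lemma measurable_path_shift [measurable]: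
  "(\<lambda>R n. R (n + k)) \<in> path_space \<rightarrow>\<^sub>M path_space"
proof -
  have "(\<lambda>R. R (n + k)) \<in> path_space \<rightarrow>\<^sub>M count_space UNIV" for n :: nat
    by measurable
  thus ?thesis
    by (subst (2) path_space_def) (rule measurable_PiM_single', auto)
qed

text \<open>The first step \<open>s\<close> is independent of the remaining ones, and the path seen
  from time 1 consists of their partial sums started at \<open>y + s\<close>. Substituting
  \<open>w = y + s\<close> gives the sum over positions.\<close>

lemma emeasure_rw_law_shift:
  assumes [measurable]: "Measurable.pred path_space E"
  shows "emeasure (rw_law p y) {R. E (\<lambda>n. R (n + 1))} =
    (\<integral>\<^sup>+w. pmf p (w - y) * emeasure (rw_law p w) {R. E R} \<partial>count_space UNIV)"
proof -
  let ?S = "stream_space (measure_pmf p)"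
  have E: "Measurable.pred path_space (\<lambda>R. E (\<lambda>n. R (n + 1)))"
    by measurable
  have "emeasure (rw_law p y) {R. E (\<lambda>n. R (n + 1))} =
      emeasure ?S {\<xi>\<in>space ?S. E (\<lambda>n. y + (\<Sum>i<n + 1. \<xi> !! i))}"
    by (subst emeasure_rw_law[OF E]) (rule refl)
  also have "\<dots> = (\<integral>\<^sup>+s. emeasure ?S {\<xi>\<in>space ?S. s ## \<xi> \<in>
      {\<xi>\<in>space ?S. E (\<lambda>n. y + (\<Sum>i<n + 1. \<xi> !! i))}} \<partial>measure_pmf p)"
  proof (rule prob_space.emeasure_stream_space[OF prob_space_measure_pmf])
    have "(\<lambda>\<xi> n. y + (\<Sum>i<n. \<xi> !! i)) -` {R\<in>space path_space. E (\<lambda>n. R (n + 1))} \<inter> space ?S \<in> sets ?S"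
      by (rule measurable_sets[OF measurable_walk]) measurable
    thus "{\<xi>\<in>space ?S. E (\<lambda>n. y + (\<Sum>i<n + 1. \<xi> !! i))} \<in> sets ?S"
      by (simp add: vimage_def Int_def space_path_space conj_commute)
  qed
  also have "\<dots> = (\<integral>\<^sup>+s. emeasure (rw_law p (y + s)) {R. E R} \<partial>measure_pmf p)"
    by (intro nn_integral_cong, subst emeasure_rw_law[OF assms])
       (simp add: stream_space_Stream sum.lessThan_Suc_shift add.assoc del: sum.lessThan_Suc)
  also have "\<dots> = (\<integral>\<^sup>+s. pmf p s * emeasure (rw_law p (y + s)) {R. E R} \<partial>count_space UNIV)"
    by (rule nn_integral_measure_pmf)
  also have "\<dots> = (\<integral>\<^sup>+w. pmf p (w - y) * emeasure (rw_law p w) {R. E R} \<partial>count_space UNIV)"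
    by (subst nn_integral_bij_count_space[where g = "\<lambda>w. w - y" and A = UNIV and B = UNIV, symmetric])
       (auto simp: bij_diff intro!: bij_betwI[where g = "\<lambda>w. w + y"])
  finally show ?thesis .
qed

lemma emeasure_rw_law_start:
  assumes [measurable]: "Measurable.pred path_space E"
  shows "emeasure (rw_law p y) {R. Q (R 0) \<and> E R} =
    (if Q y then emeasure (rw_law p y) {R. E R} else 0)"
proof -
  have "Measurable.pred path_space (\<lambda>R. Q (R 0) \<and> E R)"
    by measurable
  thus ?thesis
    by (simp add: emeasure_rw_law assms)
qed

text \<open>The Markov property at time \<open>n + 1\<close>, by iterating the one at time 1. The
  future event \<open>E\<close> is kept general: the trivial event serves for the hitting position,
  and one further step serves for the entrance edge.\<close>

lemma emeasure_taboo:
  assumes [measurable]: "Measurable.pred path_space E"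
  shows "emeasure (rw_law p y)
      {R. (\<forall>k\<in>{1..n}. R k \<notin> A) \<and> R (Suc n) = z \<and> E (\<lambda>k. R (k + Suc n))} =
    taboo p A n y z * emeasure (rw_law p z) {R. E R}"
proof (induction n arbitrary: y)
  case 0
  have "emeasure (rw_law p y) {R. R 1 = z \<and> E (\<lambda>k. R (k + 1))} =
      (\<integral>\<^sup>+w. pmf p (w - y) * emeasure (rw_law p w) {R. R 0 = z \<and> E R} \<partial>count_space UNIV)"
    using emeasure_rw_law_shift[of "\<lambda>R. R 0 = z \<and> E R" p y] by simp
  also have "\<dots> = (\<integral>\<^sup>+w. pmf p (w - y) * emeasure (rw_law p w) {R. E R} * indicator {z} w \<partial>count_space UNIV)"
    by (intro nn_integral_cong) (auto simp: emeasure_rw_law_start[of E _ _ "\<lambda>v. v = z"] split: split_indicator)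
  finally show ?case
    by (simp add: nn_integral_count_space_indicator_singleton)
next
  case (Suc n)
  let ?E = "\<lambda>R. (\<forall>k\<in>{1..n}. R k \<notin> A) \<and> R (Suc n) = z \<and> E (\<lambda>k. R (k + Suc n))"
  have E [measurable]: "Measurable.pred path_space ?E"
    by measurable
  have avoid: "(\<forall>k\<in>{1..Suc n}. R k \<notin> A) \<longleftrightarrow> R (Suc 0) \<notin> A \<and> (\<forall>k\<in>{1..n}. R (Suc k) \<notin> A)" for R :: "nat \<Rightarrow> int"
  proof -
    have "{1..Suc n} = insert (Suc 0) (Suc ` {1..n})"
      by (auto simp: image_Suc_atLeastAtMost)
    hence "(\<forall>k\<in>{1..Suc n}. R k \<notin> A) \<longleftrightarrow> (\<forall>k\<in>insert (Suc 0) (Suc ` {1..n}). R k \<notin> A)"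
      by (rule arg_cong)
    also have "\<dots> \<longleftrightarrow> R (Suc 0) \<notin> A \<and> (\<forall>k\<in>{1..n}. R (Suc k) \<notin> A)"
      by (simp del: image_Suc_atLeastAtMost)
    finally show ?thesis .
  qed
  have shift: "{R. (\<forall>k\<in>{1..Suc n}. R k \<notin> A) \<and> R (Suc (Suc n)) = z \<and> E (\<lambda>k. R (k + Suc (Suc n)))} =
      {R. R (0 + 1) \<notin> A \<and> ?E (\<lambda>k. R (k + 1))}"
    unfolding avoid by simp
  have pred: "Measurable.pred path_space (\<lambda>R. R 0 \<notin> A \<and> ?E R)"
    by measurable
  have "emeasure (rw_law p y)
        {R. (\<forall>k\<in>{1..Suc n}. R k \<notin> A) \<and> R (Suc (Suc n)) = z \<and> E (\<lambda>k. R (k + Suc (Suc n)))} =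
      (\<integral>\<^sup>+w. pmf p (w - y) * emeasure (rw_law p w) {R. R 0 \<notin> A \<and> ?E R} \<partial>count_space UNIV)"
    unfolding shift by (rule emeasure_rw_law_shift[OF pred])
  also have "\<dots> = (\<integral>\<^sup>+w. ennreal (pmf p (w - y)) * indicator (- A) w * taboo p A n w z *
      emeasure (rw_law p z) {R. E R} \<partial>count_space UNIV)"
  proof (rule nn_integral_cong)
    fix w
    have "emeasure (rw_law p w) {R. R 0 \<notin> A \<and> ?E R} =
        (if w \<notin> A then taboo p A n w z * emeasure (rw_law p z) {R. E R} else 0)"
      by (simp only: emeasure_rw_law_start[of ?E _ _ "\<lambda>v. v \<notin> A", OF E] Suc.IH)
    thus "ennreal (pmf p (w - y)) * emeasure (rw_law p w) {R. R 0 \<notin> A \<and> ?E R} =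
        ennreal (pmf p (w - y)) * indicator (- A) w * taboo p A n w z * emeasure (rw_law p z) {R. E R}"
      by (simp only:) (simp add: mult.assoc)
  qed
  finally show ?case
    by (simp add: nn_integral_multc)
qed

section \<open>Events at the hitting time as sums over fixed times\<close>

lemma hit_time_eq_enat_Suc_iff:
  "hit_time A R = enat (Suc n) \<longleftrightarrow> (\<forall>k\<in>{1..n}. R k \<notin> A) \<and> R (Suc n) \<in> A"
proof
  assume "hit_time A R = enat (Suc n)"
  hence ex: "\<exists>k>0. R k \<in> A" and n: "(LEAST k. 0 < k \<and> R k \<in> A) = Suc n"
    by (auto simp: hit_time_eq split: if_splits)
  have "R k \<notin> A" if "1 \<le> k" "k \<le> n" for k
  proof -
    have "k < (LEAST k. 0 < k \<and> R k \<in> A)"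
      using that n by simp
    from not_less_Least[OF this] that show ?thesis by simp
  qed
  moreover have "R (Suc n) \<in> A"
    using LeastI_ex[OF ex] n by simp
  ultimately show "(\<forall>k\<in>{1..n}. R k \<notin> A) \<and> R (Suc n) \<in> A"
    by simp
next
  assume *: "(\<forall>k\<in>{1..n}. R k \<notin> A) \<and> R (Suc n) \<in> A"
  hence "(LEAST k. 0 < k \<and> R k \<in> A) = Suc n"
    by (intro Least_equality) (auto simp: not_less_eq_eq[symmetric])
  with * show "hit_time A R = enat (Suc n)"
    by (auto simp: hit_time_eq)
qed

lemma hit_time_less_infinity_iff: "hit_time A R < \<infinity> \<longleftrightarrow> (\<exists>n. hit_time A R = enat (Suc n))"
proof
  assume "hit_time A R < \<infinity>"
  hence ex: "\<exists>k>0. R k \<in> A"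
    by (auto simp: hit_time_eq split: if_splits)
  have "0 < (LEAST k. 0 < k \<and> R k \<in> A)"
    using LeastI_ex[OF ex] by simp
  thus "\<exists>n. hit_time A R = enat (Suc n)"
    using ex by (auto simp: hit_time_eq gr0_conv_Suc)
qed auto

text \<open>Finite hitting times are positive, so the pieces \<open>Suc n\<close> exhaust the event,
  and on each of them \<open>the_enat\<close> returns a fixed time.\<close>

lemma at_hit_time_eq_UN:
  "{R. P (the_enat (hit_time A R)) R \<and> hit_time A R < \<infinity>} =
    (\<Union>n. {R. hit_time A R = enat (Suc n) \<and> P (Suc n) R})"
  unfolding hit_time_less_infinity_iff by force

lemma sets_at_hit_time_Suc:
  assumes [measurable]: "\<And>n. Measurable.pred path_space (P n)"
  shows "{R. hit_time A R = enat (Suc n) \<and> P (Suc n) R} \<in> sets (rw_law p y)"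
proof -
  have "Measurable.pred path_space (\<lambda>R. hit_time A R = enat (Suc n) \<and> P (Suc n) R)"
    by measurable
  thus ?thesis by (auto simp: pred_def space_path_space sets_rw_law)
qed

lemma sets_at_hit_time:
  assumes "\<And>n. Measurable.pred path_space (P n)"
  shows "{R. P (the_enat (hit_time A R)) R \<and> hit_time A R < \<infinity>} \<in> sets (rw_law p y)"
  unfolding at_hit_time_eq_UN using sets_at_hit_time_Suc[of P, OF assms]
  by (intro sets.countable_UN) (rule image_subsetI)

lemma emeasure_at_hit_time:
  assumes "\<And>n. Measurable.pred path_space (P n)"
  shows "emeasure (rw_law p y) {R. P (the_enat (hit_time A R)) R \<and> hit_time A R < \<infinity>} =
    (\<Sum>n. emeasure (rw_law p y) {R. hit_time A R = enat (Suc n) \<and> P (Suc n) R})"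
  unfolding at_hit_time_eq_UN
proof (rule suminf_emeasure[symmetric])
  show "range (\<lambda>n. {R. hit_time A R = enat (Suc n) \<and> P (Suc n) R}) \<subseteq> sets (rw_law p y)"
    using sets_at_hit_time_Suc[of P, OF assms] by (rule image_subsetI)
  show "disjoint_family (\<lambda>n. {R. hit_time A R = enat (Suc n) \<and> P (Suc n) R})"
    by (auto simp: disjoint_family_on_def)
qed

lemma emeasure_hitting_position:
  assumes "z \<in> A"
  shows "emeasure (rw_law p y) {R. R (the_enat (hit_time A R)) = z \<and> hit_time A R < \<infinity>} =
    taboo_green p A y z"
proof -
  interpret prob_space "rw_law p z" by (rule prob_space_rw_law)
  have eq: "{R. hit_time A R = enat (Suc n) \<and> R (Suc n) = z} =
      {R. (\<forall>k\<in>{1..n}. R k \<notin> A) \<and> R (Suc n) = z \<and> True}" for n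
    using assms by (auto simp: hit_time_eq_enat_Suc_iff)
  have "emeasure (rw_law p y) {R. R (the_enat (hit_time A R)) = z \<and> hit_time A R < \<infinity>} =
      (\<Sum>n. emeasure (rw_law p y) {R. hit_time A R = enat (Suc n) \<and> R (Suc n) = z})"
    by (rule emeasure_at_hit_time[of "\<lambda>n R. R n = z"]) measurable
  also have "\<dots> = taboo_green p A y z"
    unfolding eq taboo_green_def using emeasure_space_1
    by (subst emeasure_taboo) (auto simp: space_rw_law)
  finally show ?thesis .
qed

lemma emeasure_rw_law_trans_prob: "emeasure (rw_law p x) {R. R 1 = a} = ennreal (trans_prob p x a)"
proof -
  interpret prob_space "rw_law p x" by (rule prob_space_rw_law)
  show ?thesis by (simp add: trans_prob_def emeasure_eq_measure space_rw_law)
qed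

text \<open>Each visit to \<open>x\<close> before hitting \<open>A\<close> offers one chance to step
  to \<open>a\<close>. The indicator is the visit at time 0, which \<open>taboo_green\<close> omits.
  The identity stays in \<open>ennreal\<close>, because the Green function at \<open>x\<close> is
  not yet known to be finite.\<close>

lemma emeasure_hitting_edge:
  assumes "x \<notin> A" "a \<in> A"
  shows "emeasure (rw_law p y)
      {R. (R (the_enat (hit_time A R)) = a \<and> R (the_enat (hit_time A R) - 1) = x) \<and> hit_time A R < \<infinity>} =
    (indicator {x} y + taboo_green p A y x) * ennreal (trans_prob p x a)"
proof -
  let ?P = "\<lambda>n R. R n = a \<and> R (n - 1) = x"
  let ?H = "\<lambda>n. {R. hit_time A R = enat (Suc n) \<and> ?P (Suc n) R}"
  have H: "emeasure (rw_law p y) (?H (n + 1)) = taboo p A n y x * ennreal (trans_prob p x a)" for n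
  proof -
    \<comment> \<open>The hitting time here is \<open>n + 2\<close>; avoidance at time
      \<open>n + 1\<close> follows from \<open>x \<notin> A\<close>, which leaves \<open>n\<close>
      taboo positions.\<close>
    have "?H (n + 1) = {R. (\<forall>k\<in>{1..n}. R k \<notin> A) \<and> R (Suc n) = x \<and> R (1 + Suc n) = a}"
      using assms by (auto simp: hit_time_eq_enat_Suc_iff le_Suc_eq)
    thus ?thesis
      using emeasure_taboo[of "\<lambda>R. R 1 = a" p y n A x]
      by (simp add: emeasure_rw_law_trans_prob[simplified])
  qed
  have "emeasure (rw_law p y)
      {R. (R (the_enat (hit_time A R)) = a \<and> R (the_enat (hit_time A R) - 1) = x) \<and> hit_time A R < \<infinity>} =
      (\<Sum>n. emeasure (rw_law p y) (?H n))"
    by (rule emeasure_at_hit_time[of ?P]) measurable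
  also have "\<dots> = (\<Sum>n. emeasure (rw_law p y) (?H (n + 1))) + emeasure (rw_law p y) (?H 0)"
    using suminf_offset[of "\<lambda>n. emeasure (rw_law p y) (?H n)" 1] by simp
  also have "?H 0 = {R. R 0 = x \<and> R 1 = a}"
    using assms by (auto simp: hit_time_eq_enat_Suc_iff)
  also have "emeasure (rw_law p y) \<dots> = indicator {x} y * ennreal (trans_prob p x a)"
    by (subst emeasure_rw_law_start[of "\<lambda>R. R 1 = a" _ _ "\<lambda>v. v = x"])
       (auto simp: emeasure_rw_law_trans_prob[simplified])
  finally show ?thesis
    by (simp only: H taboo_green_def ennreal_suminf_multc distrib_right add.commute)
qed


lemma sets_hit_time_less_infinity: "{R. hit_time A R < \<infinity>} \<in> sets (rw_law p y)"
  using sets_at_hit_time[of "\<lambda>_ _. True" A p y] by simp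

section \<open>Real-valued Green functions and escape probabilities\<close>

text \<open>An infinite value would become 0. For \<open>z \<in> A\<close> the value is a
  probability, so nothing is lost; for \<open>x\<close> outside \<open>A\<close>, finiteness at
  \<open>(x, x)\<close> is established in \<open>green_insert_return\<close>.\<close>

definition green :: "int pmf \<Rightarrow> int set \<Rightarrow> int \<Rightarrow> int \<Rightarrow> real" where
  "green p A y z = enn2real (taboo_green p A y z)"

lemma green_nonneg: "0 \<le> green p A y z"
  by (simp add: green_def)

lemma green_rev_step: "green (rev_step p) A y z = green p A z y"
  by (simp add: green_def taboo_green_rev_step)

lemma taboo_green_le_1:
  assumes "z \<in> A"
  shows "taboo_green p A y z \<le> 1"
proof -
  interpret prob_space "rw_law p y" by (rule prob_space_rw_law)
  show ?thesis
    unfolding emeasure_hitting_position[OF assms, symmetric] by (rule emeasure_le_1)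
qed

lemma taboo_green_eq_green: "z \<in> A \<Longrightarrow> taboo_green p A y z = ennreal (green p A y z)"
  using taboo_green_le_1[of z A p y] unfolding green_def
  by (subst ennreal_enn2real) (auto simp: le_less_trans[OF _ ennreal_one_less_top])

lemma prob_hitting_position:
  assumes "z \<in> A"
  shows "\<P>(R in rw_law p y. R (the_enat (hit_time A R)) = z \<and> hit_time A R < \<infinity>) = green p A y z"
  using emeasure_hitting_position[OF assms, of p y]
  by (simp add: green_def space_rw_law measure_def)

lemma prob_hit_time_less_infinity:
  assumes "finite A"
  shows "\<P>(R in rw_law p y. hit_time A R < \<infinity>) = (\<Sum>z\<in>A. green p A y z)"
proof -
  interpret prob_space "rw_law p y" by (rule prob_space_rw_law)
  let ?H = "\<lambda>z. {R. R (the_enat (hit_time A R)) = z \<and> hit_time A R < \<infinity>}"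
  have "R (the_enat (hit_time A R)) \<in> A" if finite_time: "hit_time A R < \<infinity>" for R
  proof -
    obtain n where n: "hit_time A R = enat (Suc n)"
      using finite_time unfolding hit_time_less_infinity_iff by blast
    with hit_time_eq_enat_Suc_iff[THEN iffD1, OF n] show ?thesis
      by simp
  qed
  hence "{R. hit_time A R < \<infinity>} = (\<Union>z\<in>A. ?H z)"
    by blast
  moreover have "?H z \<in> events" for z
    by (rule sets_at_hit_time[of "\<lambda>n R. R n = z"]) measurable
  hence "?H ` A \<subseteq> events"
    by (rule image_subsetI)
  moreover have "disjoint_family_on ?H A"
    by (auto simp: disjoint_family_on_def)
  ultimately have "prob {R. hit_time A R < \<infinity>} = (\<Sum>z\<in>A. prob (?H z))"
    using finite_measure_finite_Union[OF assms, of ?H] by (simp only:)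
  also have "\<dots> = (\<Sum>z\<in>A. green p A y z)"
    by (rule sum.cong) (simp_all only: prob_hitting_position[simplified space_rw_law UNIV_I simp_thms])
  finally show ?thesis
    by (simp only: space_rw_law UNIV_I simp_thms)
qed

lemma prob_hitting_edge:
  assumes "x \<notin> A" "a \<in> A" "y \<noteq> x"
  shows "\<P>(R in rw_law p y. (R (the_enat (hit_time A R)) = a \<and> R (the_enat (hit_time A R) - 1) = x) \<and>
      hit_time A R < \<infinity>) = green p A y x * trans_prob p x a"
proof -
  have "0 \<le> trans_prob p x a"
    by (simp add: trans_prob_def)
  with assms(3) emeasure_hitting_edge[OF assms(1,2), of p y] show ?thesis
    by (simp add: green_def space_rw_law measure_def enn2real_mult)
qed

lemma cond_prob_hitting_position:
  assumes "finite A" "z \<in> A"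
  shows "\<P>(R in rw_law p y. R (the_enat (hit_time A R)) = z \<bar> hit_time A R < \<infinity>) =
    green p A y z / (\<Sum>b\<in>A. green p A y b)"
  unfolding cond_prob_def prob_hitting_position[OF assms(2)] prob_hit_time_less_infinity[OF assms(1)]
  by (rule refl)

text \<open>Escape is the complement of hitting \<open>A\<close>, and reversal swaps the arguments,
  so the starting point \<open>y\<close> appears as the second one.\<close>

lemma rev_escape_eq:
  assumes "finite A"
  shows "rev_escape p A y = 1 - (\<Sum>z\<in>A. green p A z y)"
proof -
  interpret prob_space "rw_law (rev_step p) y" by (rule prob_space_rw_law)
  have "{R. \<forall>n>0. R n \<notin> A} = space (rw_law (rev_step p) y) - {R. hit_time A R < \<infinity>}"
    by (auto simp: hit_time_eq space_rw_law split: if_splits)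
  moreover have "{R. hit_time A R < \<infinity>} \<in> events"
    by (rule sets_hit_time_less_infinity)
  ultimately have "rev_escape p A y = 1 - prob {R. hit_time A R < \<infinity>}"
    by (simp add: rev_escape_def space_rw_law prob_compl[simplified space_rw_law])
  thus ?thesis
    using prob_hit_time_less_infinity[OF assms, of "rev_step p" y]
    by (simp add: space_rw_law green_rev_step)
qed

text \<open>With \<open>z \<in> A\<close> every term is a hitting probability, so the identity in
  \<open>ennreal\<close> descends to the reals.\<close>

lemma green_insert:
  assumes "x \<notin> A" "z \<in> A"
  shows "green p A y z = green p (insert x A) y z + green p (insert x A) y x * green p A x z"
proof -
  have "ennreal (green p A y z) =
      ennreal (green p (insert x A) y z + green p (insert x A) y x * green p A x z)"
    using taboo_green_insert[OF assms(1), of p y z] assms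
    by (simp add: taboo_green_eq_green ennreal_plus ennreal_mult green_nonneg)
  thus ?thesis
    by (subst (asm) ennreal_inj) (auto simp: green_nonneg)
qed

text \<open>This is \<open>green_insert\<close> for the reversed walk, passed to complements: that
  walk escapes from \<open>A\<close> by avoiding \<open>insert x A\<close>, or by first hitting this
  set at \<open>x\<close> and escaping from there.\<close>

lemma rev_escape_insert:
  assumes "finite A" "x \<notin> A"
  shows "rev_escape p A y = rev_escape p (insert x A) y + green p (insert x A) x y * rev_escape p A x"
proof -
  have "(\<Sum>z\<in>A. green p A z y) =
      (\<Sum>z\<in>A. green p (insert x A) z y + green p (insert x A) x y * green p A z x)"
    using green_insert[OF assms(2), of _ "rev_step p" y]
    by (intro sum.cong) (auto simp: green_rev_step)
  thus ?thesis
    using assms by (simp add: rev_escape_eq sum.distrib sum_distrib_left algebra_simps)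
qed

text \<open>Every visit to \<open>x\<close> enters \<open>A\<close> along the edge to
  \<open>a\<close> with the same positive probability, and these disjoint events have total mass at
  most 1. Hence the expected number of visits is finite, the return probability is below 1, and the
  visits form a geometric series.\<close>

lemma green_insert_return:
  assumes "x \<notin> A" "a \<in> A" "trans_prob p x a \<noteq> 0"
  shows "green p (insert x A) x x < 1"
    and "green p A y x * (1 - green p (insert x A) x x) = green p (insert x A) y x"
proof -
  let ?B = "insert x A" and ?t = "ennreal (trans_prob p x a)"
  interpret prob_space "rw_law p x" by (rule prob_space_rw_law)
  have "0 < trans_prob p x a"
    using assms(3) by (simp add: trans_prob_def less_le measure_nonneg)
  hence t: "?t \<noteq> 0" by simp
  have le: "(indicator {x} x + taboo_green p A x x) * ?t \<le> 1"
    unfolding emeasure_hitting_edge[OF assms(1,2), symmetric] by (rule emeasure_le_1)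
  have "taboo_green p A x x \<noteq> \<top>"
  proof
    assume "taboo_green p A x x = \<top>"
    with le t show False by (simp add: ennreal_top_mult top_unique)
  qed
  hence fin: "taboo_green p A x x = ennreal (green p A x x)"
    by (simp add: green_def less_top)
  have eq': "green p A y x = green p ?B y x * (1 + green p A x x)" for y
  proof -
    have "taboo_green p A y x =
        ennreal (green p ?B y x) + ennreal (green p ?B y x) * ennreal (green p A x x)"
      by (subst taboo_green_insert[OF assms(1)]) (simp only: taboo_green_eq_green[of x ?B] insertI1 fin)
    also have "\<dots> = ennreal (green p ?B y x * (1 + green p A x x))"
      by (simp add: ennreal_mult green_nonneg distrib_left)
    finally show ?thesis
      unfolding green_def[of p A y x] by (simp add: green_nonneg)
  qed
  \<comment> \<open>By \<open>eq'\<close> at \<open>x\<close> the left side equals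
    \<open>green p A x x\<close>.\<close>
  have "green p ?B x x * (1 + green p A x x) < 1 + green p A x x"
    using eq'[of x] by linarith
  thus lt: "green p ?B x x < 1"
    using green_nonneg[of p A x x] by (simp add: mult_less_cancel_right)
  have "(1 + green p A x x) * (1 - green p ?B x x) = 1"
    using eq'[of x] by algebra
  thus "green p A y x * (1 - green p ?B x x) = green p ?B y x"
    unfolding eq'[of y] mult.assoc by simp
qed

section \<open>Behaviour at infinity and the limit\<close>

lemma eventually_notin_int_at_infinity:
  assumes "finite A"
  shows "eventually (\<lambda>y. y \<notin> A) int_at_infinity"
proof -
  \<comment> \<open>Inserting 0 keeps the maximum meaningful when \<open>A\<close> is empty.\<close>
  have N: "\<bar>v\<bar> < Max (insert 0 (abs ` A)) + 1" if "v \<in> A" for v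
    using assms that by (intro zle_add1_eq_le[THEN iffD2] Max_ge) auto
  show ?thesis
    unfolding int_at_infinity_def eventually_filtercomap
    by (intro exI[of _ "\<lambda>v. Max (insert 0 (abs ` A)) + 1 \<le> v"] conjI eventually_ge_at_top)
       (auto simp: not_le[symmetric] dest: N)
qed

text \<open>Irreducibility may provide a visit at time 0, which \<open>hit_time\<close> ignores;
  \<open>y \<notin> A\<close> rules this out. The conditional probabilities then have nonzero
  denominators.\<close>

lemma prob_hit_time_pos:
  assumes "rw_irreducible p" "A \<noteq> {}" "y \<notin> A"
  shows "0 < \<P>(R in rw_law p y. hit_time A R < \<infinity>)"
proof -
  interpret prob_space "rw_law p y" by (rule prob_space_rw_law)
  obtain a where a: "a \<in> A" using assms by blast
  obtain n where n: "0 < prob {R. R n = a}"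
    using assms(1) by (auto simp: rw_irreducible_def space_rw_law)
  have "n \<noteq> 0"
  proof
    assume "n = 0"
    hence "emeasure (rw_law p y) {R. R n = a} = 0"
      using emeasure_rw_law_start[of "\<lambda>_. True" p y "\<lambda>v. v = a"] a assms(3) by auto
    with n show False by (simp add: measure_def)
  qed
  hence "{R. R n = a} \<subseteq> {R. hit_time A R < \<infinity>}"
    using a by (auto simp: hit_time_eq)
  hence "prob {R. R n = a} \<le> prob {R. hit_time A R < \<infinity>}"
    by (intro finite_measure_mono sets_hit_time_less_infinity)
  with n show ?thesis
    by (simp only: space_rw_law UNIV_I simp_thms)
qed

text \<open>With junk values \<open>x / 0 = 0\<close>, a vanishing capacity would make all limits zero, but
  hitting probabilities conditioned on hitting add up to one.\<close>

lemma capacity_nonzero: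
  assumes "rw_irreducible p" "has_harmonic_measure p" "finite A" "A \<noteq> {}"
  shows "capacity p A \<noteq> 0"
proof
  assume 0: "capacity p A = 0"
  have "((\<lambda>y. \<Sum>a\<in>A. green p A y a / (\<Sum>z\<in>A. green p A y z)) \<longlongrightarrow> (\<Sum>a\<in>A. 0)) int_at_infinity"
  proof (rule tendsto_sum)
    fix a assume "a \<in> A"
    with assms have "((\<lambda>y. \<P>(R in rw_law p y. R (the_enat (hit_time A R)) = a \<bar> hit_time A R < \<infinity>))
         \<longlongrightarrow> rev_escape p A a / capacity p A) int_at_infinity"
      unfolding has_harmonic_measure_def by blast
    thus "((\<lambda>y. green p A y a / (\<Sum>z\<in>A. green p A y z)) \<longlongrightarrow> 0) int_at_infinity"
      by (simp only: 0 cond_prob_hitting_position[OF assms(3) \<open>a \<in> A\<close>] div_by_0)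
  qed
  moreover have "eventually (\<lambda>y. (\<Sum>a\<in>A. green p A y a / (\<Sum>z\<in>A. green p A y z)) = 1) int_at_infinity"
    using eventually_notin_int_at_infinity[OF assms(3)]
  proof eventually_elim
    case (elim y)
    thus ?case
      using prob_hit_time_pos[OF assms(1,4), of y]
      unfolding prob_hit_time_less_infinity[OF assms(3)] by (simp flip: sum_divide_distrib)
  qed
  ultimately have "((\<lambda>_. 1 :: real) \<longlongrightarrow> (\<Sum>a\<in>A. 0)) int_at_infinity"
    by (rule Lim_transform_eventually)
  thus False
    by (simp add: tendsto_const_iff int_at_infinity_neq_bot)
qed

theorem lemma5:
  fixes p :: "int pmf" and A :: "int set" and x a :: int
  assumes "rw_irreducible p" and "rw_transient p" and "has_harmonic_measure p"
    and "finite A" and "A \<noteq> {}" and "x \<notin> A" and "a \<in> A"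
  shows "((\<lambda>y. \<P>(R in rw_law p y.
              R (the_enat (hit_time A R)) = a \<and> R (the_enat (hit_time A R) - 1) = x
              \<bar> hit_time A R < \<infinity>))
          \<longlongrightarrow> trans_prob p x a * rev_escape p A x / capacity p A) int_at_infinity"
proof -
  define B where "B = insert x A"
  define t where "t = trans_prob p x a"
  \<comment> \<open>From \<open>x\<close>, the walk hits \<open>B\<close> at \<open>x\<close> with
    probability \<open>r\<close> and hits \<open>A\<close> with probability \<open>h\<close>; from
    \<open>y\<close> it hits \<open>B\<close> with probability \<open>U y\<close>.\<close>
  define r where "r = green p B x x"
  define h where "h = (\<Sum>b\<in>A. green p A x b)"
  define U where "U = (\<lambda>y. \<Sum>b\<in>B. green p B y b)"
  have B: "finite B" "B \<noteq> {}" "x \<in> B" "A \<subseteq> B"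
    using assms by (auto simp: B_def)
  have cond: "\<P>(R in rw_law p y. R (the_enat (hit_time A R)) = a \<and> R (the_enat (hit_time A R) - 1) = x
      \<bar> hit_time A R < \<infinity>) = green p A y x * t / (\<Sum>b\<in>A. green p A y b)" if "y \<noteq> x" for y
    unfolding cond_prob_def prob_hitting_edge[OF assms(6,7) that] prob_hit_time_less_infinity[OF assms(4)]
    by (simp add: t_def)
  have cap_A: "capacity p A \<noteq> 0" and cap_B: "capacity p B \<noteq> 0"
    using capacity_nonzero[OF assms(1,3)] assms(4,5) B by blast+
  show ?thesis
  \<comment> \<open>If \<open>t = 0\<close>, the edge carries no mass and both sides vanish for
    \<open>y \<noteq> x\<close>. Otherwise the edge yields \<open>r < 1\<close>, so that
    \<open>1 - r\<close> can be divided by.\<close>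
  proof (cases "t = 0")
    case True
    have "eventually (\<lambda>y. y \<notin> {x}) int_at_infinity"
      by (rule eventually_notin_int_at_infinity) simp
    hence "eventually (\<lambda>y. 0 = \<P>(R in rw_law p y. R (the_enat (hit_time A R)) = a \<and>
        R (the_enat (hit_time A R) - 1) = x \<bar> hit_time A R < \<infinity>)) int_at_infinity"
    proof eventually_elim
      case (elim y)
      hence "y \<noteq> x" by simp
      from cond[OF this] True show ?case by (simp only: mult_zero_right div_0)
    qed
    thus ?thesis
      using True by (intro Lim_transform_eventually[OF tendsto_const]) (auto simp: t_def)
  next
    case False
    note return = green_insert_return[OF assms(6,7) False[unfolded t_def], folded B_def, folded r_def]
    \<comment> \<open>Summing the decomposition from \<open>x\<close> over \<open>A\<close> gives
      \<open>h\<close> as the sum on the right plus \<open>r * h\<close>.\<close>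
    have hr: "h * (1 - r) = (\<Sum>b\<in>A. green p B x b)"
      unfolding h_def sum_distrib_right
      using green_insert[OF assms(6), of _ p x, folded B_def, folded r_def]
      by (intro sum.cong refl) (simp add: algebra_simps)
    have esc: "rev_escape p A x * (1 - r) = rev_escape p B x"
      using rev_escape_insert[OF assms(4,6), of p x] by (simp add: B_def r_def algebra_simps)
    \<comment> \<open>Expresses the capacity of \<open>A\<close> through \<open>B\<close>: the
      \<open>x\<close>-terms sum to \<open>h * (1 - r)\<close> times the escape probability from
      \<open>A\<close> at \<open>x\<close>, and \<open>esc\<close> absorbs the factor
      \<open>1 - r\<close>.\<close>
    have cap: "capacity p A = (\<Sum>b\<in>A. rev_escape p B b) + rev_escape p B x * h"
    proof -
      have "capacity p A = (\<Sum>b\<in>A. rev_escape p B b + green p B x b * rev_escape p A x)"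
        unfolding capacity_def B_def
        by (intro sum.cong rev_escape_insert assms refl)
      also have "\<dots> = (\<Sum>b\<in>A. rev_escape p B b) + h * (1 - r) * rev_escape p A x"
        by (simp add: hr sum.distrib sum_distrib_right)
      finally show ?thesis
        by (simp add: esc[symmetric] mult_ac)
    qed
    have lim: "((\<lambda>y. green p B y b / U y) \<longlongrightarrow> rev_escape p B b / capacity p B) int_at_infinity"
      if "b \<in> B" for b
    proof -
      have "((\<lambda>y. \<P>(R in rw_law p y. R (the_enat (hit_time B R)) = b \<bar> hit_time B R < \<infinity>))
         \<longlongrightarrow> rev_escape p B b / capacity p B) int_at_infinity"
        using assms(3) B that unfolding has_harmonic_measure_def by blast
      thus ?thesis
        by (simp only: cond_prob_hitting_position[OF B(1) that] U_def)
    qed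
    \<comment> \<open>Numerator and denominator are divided by \<open>U y\<close>, which turns each
      Green function of \<open>B\<close> into a conditional hitting probability with a known limit.
      The denominator tends to \<open>capacity p A / capacity p B\<close>, which is nonzero.\<close>
    have "((\<lambda>y. green p B y x / U y / (1 - r) * t /
          ((\<Sum>b\<in>A. green p B y b / U y) + green p B y x / U y * h)) \<longlongrightarrow>
        rev_escape p B x / capacity p B / (1 - r) * t /
          ((\<Sum>b\<in>A. rev_escape p B b / capacity p B) + rev_escape p B x / capacity p B * h)) int_at_infinity"
      using return(1) cap_A cap_B B
      by (intro tendsto_divide tendsto_mult tendsto_add tendsto_sum tendsto_const lim)
         (auto simp: cap add_divide_distrib[symmetric] sum_divide_distrib[symmetric])
    also have "rev_escape p B x / capacity p B / (1 - r) * t /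
          ((\<Sum>b\<in>A. rev_escape p B b / capacity p B) + rev_escape p B x / capacity p B * h) =
        (rev_escape p B x / (1 - r) * t / capacity p B) / (capacity p A / capacity p B)"
      by (simp add: cap add_divide_distrib sum_divide_distrib mult_ac)
    also have "\<dots> = trans_prob p x a * rev_escape p A x / capacity p A"
      using return(1) cap_A cap_B by (simp add: esc[symmetric] t_def)
    finally have *: "((\<lambda>y. green p B y x / U y / (1 - r) * t /
          ((\<Sum>b\<in>A. green p B y b / U y) + green p B y x / U y * h)) \<longlongrightarrow>
        trans_prob p x a * rev_escape p A x / capacity p A) int_at_infinity" .
    show ?thesis
    proof (rule Lim_transform_eventually[OF *])
      show "eventually (\<lambda>y. green p B y x / U y / (1 - r) * t /
          ((\<Sum>b\<in>A. green p B y b / U y) + green p B y x / U y * h) =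
        \<P>(R in rw_law p y. R (the_enat (hit_time A R)) = a \<and> R (the_enat (hit_time A R) - 1) = x
          \<bar> hit_time A R < \<infinity>)) int_at_infinity"
        using eventually_notin_int_at_infinity[OF B(1)]
      proof eventually_elim
        case (elim y)
        have "U y \<noteq> 0"
          using prob_hit_time_pos[OF assms(1) B(2) elim]
          unfolding prob_hit_time_less_infinity[OF B(1)] by (simp add: U_def)
        have "(\<Sum>b\<in>A. green p A y b) = (\<Sum>b\<in>A. green p B y b + green p B y x * green p A x b)"
          unfolding B_def by (intro sum.cong green_insert assms refl)
        also have "\<dots> = U y * ((\<Sum>b\<in>A. green p B y b / U y) + green p B y x / U y * h)"
          using \<open>U y \<noteq> 0\<close>
          by (simp add: h_def sum.distrib sum_distrib_left distrib_left)
        finally have den: "(\<Sum>b\<in>A. green p A y b) =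
            U y * ((\<Sum>b\<in>A. green p B y b / U y) + green p B y x / U y * h)" .
        \<comment> \<open>The geometric series at \<open>x\<close> replaces
          \<open>green p A y x\<close> by \<open>green p B y x / (1 - r)\<close>; the factor
          \<open>U y\<close> then cancels against \<open>den\<close>.\<close>
        have num: "green p A y x * t = U y * (green p B y x / U y / (1 - r) * t)"
          using \<open>U y \<noteq> 0\<close> return(1) by (simp add: return(2)[symmetric])
        have "y \<noteq> x"
          using elim B by blast
        thus ?case
          unfolding cond[OF \<open>y \<noteq> x\<close>] den num using \<open>U y \<noteq> 0\<close> by simp
      qed
    qed
  qed
qed

end
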